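(* Let $N\ge 2$ be an integer and $M=\lfloor N/2\rfloor$. Then $\tilde{\Gamma}_{0,2,M}(N)=\dfrac{1}{2^{N}M!}$, and for every integer $j$ with $1\le j<M$, $$\tilde{\Gamma}_{0,2,M-j}(N)=\frac{(-1)^{j}}{2^{N}M!}\sum_{\substack{j_1+\cdots+j_N=j\\ j_1,\dots,j_N\ge 0}}\frac{\tilde{\gamma}_{j_1}(1)\cdots\tilde{\gamma}_{j_N}(N)}{j_1!\cdots j_N!}.$$
   Context: For $r,s,a\in\mathbb{Q}[x]$ with $a$ non-constant and $\gcd(s,a)=1$, $\mathrm{eval}(r/s;a)$ denotes the unique polynomial of degree $<\deg a$ congruent to $r s^{-1}$ modulo $a$ (i.e. the remainder of $\alpha r$ modulo $a$, where $\alpha s\equiv1\pmod a$). Convention: $\Phi_1(x)=1-x$ and $\Phi_n(x)$ ($n\ge2$) is the $n$-th cyclotomic polynomial, so $\prod_{i=1}^N(1-x^i)=\prod_{i=1}^N\Phi_i(x)^{\lfloor N/i\rfloor}$ and $\Phi_2(x)=1+x$. Let $h_2^{(N)}(x)=\mathrm{eval}\bigl(1/\prod_{1\le i\le N,\, i\ne 2}\Phi_i(x)^{\lfloor N/i\rfloor};\ (1+x)^{M}\bigr)$, a polynomial of degree $<M$, and define the rational numbers $\tilde{\Gamma}_{0,2,l}(N)$, $1\le l\le M$, by $h_2^{(N)}(x)=\sum_{l=1}^{M}\tilde{\Gamma}_{0,2,l}(N)(1+x)^{M-l}$; equivalently, $\sum_{l=1}^M\tilde{\Gamma}_{0,2,l}(N)(1+x)^{-l}$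 is the principal part of $F_N(x)=\prod_{k=1}^N(1-x^k)^{-1}$ at $x=-1$. Carlitz's degenerate Bernoulli numbers $\beta_k(\lambda)$ and degenerate Euler numbers $\varepsilon_k(\lambda)$ are defined by $$\frac{t}{(1+\lambda t)^{1/\lambda}-1}=\sum_{k\ge0}\beta_k(\lambda)\frac{t^k}{k!},\qquad \frac{2}{(1+\lambda t)^{1/\lambda}+1}=\sum_{k\ge0}\varepsilon_k(\lambda)\frac{t^k}{k!}.$$ For integers $n\ge1$, $k\ge0$: $\tilde{\gamma}_k(n)=n^k\varepsilon_k(1/n)$ if $n$ is odd and $\tilde{\gamma}_k(n)=n^k\beta_k(1/n)$ if $n$ is even. *)

theory Defs
  imports
    "HOL-Computational_Algebra.Computational_Algebra"
    "HOL-Computational_Algebra.Field_as_Ring"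
    "HOL-Number_Theory.Cong"
    "HOL-Library.FuncSet"
begin

section \<open>Cyclotomic polynomials\<close>

definition primitive_unity_roots :: "nat \<Rightarrow> complex set" where
  "primitive_unity_roots n = {z. z ^ n = 1 \<and> (\<forall>d. 0 < d \<and> d < n \<longrightarrow> z ^ d \<noteq> 1)}"

text \<open>The rational polynomial whose complex roots are, with multiplicity one, the primitive
  \<open>n\<close>-th roots of unity; it exists by \<open>of_rat_cyclotomic_poly\<close> below (for \<open>n > 0\<close>).\<close>

definition cyclotomic_poly :: "nat \<Rightarrow> rat poly" where
  "cyclotomic_poly n =
     (THE p. map_poly of_rat p = (\<Prod>z\<in>primitive_unity_roots n. [:- z, 1:]))"

text \<open>The convention here is \<open>\<Phi>\<^sub>1 = 1 - x\<close>, the opposite of the usual \<open>\<Phi>\<^sub>1\<close>.\<close>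

definition Phi :: "nat \<Rightarrow> rat poly" where
  "Phi n = (if n = 1 then [:1, - 1:] else cyclotomic_poly n)"


section \<open>Evaluation of a rational function modulo a polynomial\<close>

text \<open>Meaningful for \<open>a\<close> non-constant and \<open>coprime s a\<close>.\<close>

definition eval_mod :: "rat poly \<Rightarrow> rat poly \<Rightarrow> rat poly \<Rightarrow> rat poly" where
  "eval_mod r s a =
     (THE h. degree h < degree a \<and> (\<exists>\<alpha>. [\<alpha> * s = 1] (mod a) \<and> [h = \<alpha> * r] (mod a)))"

definition h2 :: "nat \<Rightarrow> rat poly" where
  "h2 N = eval_mod 1 (\<Prod>i\<in>{1..N} - {2}. Phi i ^ (N div i)) ([:1, 1:] ^ (N div 2))"

text \<open>\<open>Gamma02 N l\<close> is the coefficient with index triple \<open>(0, 2, l)\<close>. Outside \<open>1 \<le> l \<le> M\<close> it is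
  set to \<open>0\<close> to make the coefficient function unique.\<close>

definition Gamma02 :: "nat \<Rightarrow> nat \<Rightarrow> rat" where
  "Gamma02 N =
     (THE g. (\<forall>l. l \<notin> {1..N div 2} \<longrightarrow> g l = 0) \<and>
             h2 N = (\<Sum>l = 1..N div 2. smult (g l) ([:1, 1:] ^ (N div 2 - l))))"


section \<open>Degenerate Bernoulli and Euler numbers\<close>

text \<open>The formal power series \<open>(1 + c t)\<^bsup>1/c\<^esup>\<close>, for \<open>c \<noteq> 0\<close>
  (Carlitz's parameter \<open>\<lambda>\<close> is \<open>c\<close> here).\<close>

definition degenerate_exp :: "rat \<Rightarrow> rat fps" where
  "degenerate_exp c = fps_compose (fps_binomial (1 / c)) (fps_const c * fps_X)"

definition degenerate_bernoulli :: "nat \<Rightarrow> rat \<Rightarrow> rat" where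
  "degenerate_bernoulli k c = fact k * fps_nth (fps_X / (degenerate_exp c - 1)) k"

definition degenerate_euler :: "nat \<Rightarrow> rat \<Rightarrow> rat" where
  "degenerate_euler k c = fact k * fps_nth (2 / (degenerate_exp c + 1)) k"

definition gamma_tilde :: "nat \<Rightarrow> nat \<Rightarrow> rat" where
  "gamma_tilde k n =
     (if odd n then of_nat n ^ k * degenerate_euler k (1 / of_nat n)
      else of_nat n ^ k * degenerate_bernoulli k (1 / of_nat n))"


section \<open>Well-definedness\<close>

subsection \<open>Degenerate numbers\<close>

lemma degenerate_exp_nth_0: "fps_nth (degenerate_exp c) 0 = 1"
  by (simp add: degenerate_exp_def)

lemma degenerate_exp_nth_1: "c \<noteq> 0 \<Longrightarrow> fps_nth (degenerate_exp c) 1 = 1"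
  by (simp add: degenerate_exp_def fps_compose_nth)

lemma degenerate_exp_inverse_nat:
  assumes "n > 0"
  shows "degenerate_exp (1 / of_nat n) = (1 + fps_const (1 / of_nat n) * fps_X) ^ n"
proof -
  have "fps_binomial (of_nat n :: rat) = (1 + fps_X) ^ n"
    by (simp add: fps_binomial_of_nat)
  moreover have "fps_compose ((1 + fps_X) ^ n) g = (1 + g :: rat fps) ^ n" if "fps_nth g 0 = 0" for g
    using that by (simp add: fps_compose_power[symmetric] fps_compose_add_distrib)
  ultimately show ?thesis by (simp add: degenerate_exp_def)
qed

lemma degenerate_bernoulli_gf:
  assumes "c \<noteq> 0"
  shows "Abs_fps (\<lambda>k. degenerate_bernoulli k c / fact k) * (degenerate_exp c - 1) = fps_X"
proof -
  let ?d = "degenerate_exp c - 1"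
  have nz: "?d \<noteq> 0" and sd: "subdegree ?d = 1"
  proof -
    have 1: "fps_nth ?d 1 \<noteq> 0" using degenerate_exp_nth_1[OF assms] by simp
    thus "?d \<noteq> 0" by auto
    show "subdegree ?d = 1"
      using 1 by (intro subdegreeI) (auto simp: degenerate_exp_nth_0)
  qed
  have "?d dvd fps_X" using nz sd by (simp add: fps_dvd_iff)
  hence "fps_X / ?d * ?d = fps_X" by simp
  moreover have "Abs_fps (\<lambda>k. degenerate_bernoulli k c / fact k) = fps_X / ?d"
    by (intro fps_ext) (simp add: degenerate_bernoulli_def)
  ultimately show ?thesis by simp
qed

lemma degenerate_euler_gf:
  "Abs_fps (\<lambda>k. degenerate_euler k c / fact k) * (degenerate_exp c + 1) = 2"
proof -
  let ?d = "degenerate_exp c + 1"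
  have 0: "fps_nth ?d 0 \<noteq> 0" by (simp add: degenerate_exp_nth_0)
  hence "?d dvd 2" by (auto simp: fps_dvd_iff)
  hence "2 / ?d * ?d = 2" by simp
  moreover have "Abs_fps (\<lambda>k. degenerate_euler k c / fact k) = 2 / ?d"
    by (intro fps_ext) (simp add: degenerate_euler_def)
  ultimately show ?thesis by simp
qed

subsection \<open>Cyclotomic polynomials\<close>

lemma map_of_rat_poly_mult:
  "map_poly (of_rat :: rat \<Rightarrow> complex) (p * q) = map_poly of_rat p * map_poly of_rat q"
  by (intro poly_eqI) (simp add: coeff_map_poly coeff_mult of_rat_sum of_rat_mult)

lemma map_of_rat_poly_add:
  "map_poly (of_rat :: rat \<Rightarrow> complex) (p + q) = map_poly of_rat p + map_poly of_rat q"
  by (intro poly_eqI) (simp add: coeff_map_poly of_rat_add)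

lemma map_of_rat_poly_prod:
  "map_poly (of_rat :: rat \<Rightarrow> complex) (prod f A) = (\<Prod>x\<in>A. map_poly of_rat (f x))"
  by (induction A rule: infinite_finite_induct) (simp_all add: map_of_rat_poly_mult)

lemma map_of_rat_poly_inj:
  assumes "map_poly (of_rat :: rat \<Rightarrow> complex) p = map_poly of_rat q"
  shows "p = q"
proof (intro poly_eqI)
  fix n
  have "of_rat (coeff p n) = (of_rat (coeff q n) :: complex)"
    using assms by (metis coeff_map_poly of_rat_0)
  thus "coeff p n = coeff q n" by simp
qed

lemma finite_primitive_unity_roots: "n > 0 \<Longrightarrow> finite (primitive_unity_roots n)"
  by (rule finite_subset[of _ "{z::complex. z ^ n = 1}"])
    (auto simp: primitive_unity_roots_def intro: finite_roots_unity)

lemma unity_roots_eq_Union_primitive: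
  assumes "n > 0"
  shows "{z. z ^ n = 1} = (\<Union>d\<in>{d. d dvd n}. primitive_unity_roots d)"
proof (intro equalityI subsetI)
  fix z :: complex
  assume "z \<in> {z. z ^ n = 1}"
  hence z: "z ^ n = 1" by simp
  define d where "d = (LEAST d. d > 0 \<and> z ^ d = 1)"
  have d: "d > 0" "z ^ d = 1"
    using LeastI[of "\<lambda>d. d > 0 \<and> z ^ d = 1" n] z assms by (auto simp: d_def)
  have least: "z ^ e \<noteq> 1" if "0 < e" "e < d" for e
    using not_less_Least[of e "\<lambda>d. d > 0 \<and> z ^ d = 1"] that by (auto simp: d_def)
  have "z ^ n = z ^ (d * (n div d) + n mod d)" by simp
  also have "\<dots> = z ^ (n mod d)" by (simp only: power_add power_mult d power_one mult_1)
  finally have "z ^ (n mod d) = 1" using z by simp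
  hence "n mod d = 0" using least[of "n mod d"] d by (meson gr0I mod_less_divisor)
  hence "d dvd n" by auto
  thus "z \<in> (\<Union>d\<in>{d. d dvd n}. primitive_unity_roots d)"
    using d least by (auto simp: primitive_unity_roots_def)
next
  fix z :: complex
  assume "z \<in> (\<Union>d\<in>{d. d dvd n}. primitive_unity_roots d)"
  thus "z \<in> {z. z ^ n = 1}"
    by (auto simp: primitive_unity_roots_def power_mult elim!: dvdE)
qed

lemma prod_linear_unity_roots:
  assumes "n > 0"
  shows "(\<Prod>z | z ^ n = 1. [:- z, 1:]) = (monom 1 n - 1 :: complex poly)"
proof -
  let ?p = "\<Prod>z | z ^ n = 1. [:- z, 1:] :: complex poly"
  let ?q = "monom 1 n - 1 :: complex poly"
  have fin: "finite {z::complex. z ^ n = 1}" using assms by (intro finite_roots_unity) auto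
  have dp: "degree ?p = n"
    by (subst degree_prod_eq_sum_degree) (use assms card_roots_unity_eq in auto)
  have lp: "coeff ?p n = 1"
    using lead_coeff_prod[of "\<lambda>z. [:- z, 1:]" "{z::complex. z ^ n = 1}"] dp by simp
  have "?p = ?q"
  proof (rule ccontr)
    assume ne: "?p \<noteq> ?q"
    have c: "coeff (?p - ?q) n = 0" using lp assms by simp
    have "degree (?p - ?q) \<le> n"
      by (intro degree_diff_le) (auto simp: dp degree_monom_le)
    hence deg: "degree (?p - ?q) < n"
      using c ne assms by (metis eq_iff_diff_eq_0 le_neq_implies_less leading_coeff_0_iff)
    have "card {z::complex. z ^ n = 1} \<le> card {z. poly (?p - ?q) z = 0}"
    proof (intro card_mono poly_roots_finite)
      show "?p - ?q \<noteq> 0" using ne by simp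
      show "{z. z ^ n = 1} \<subseteq> {z. poly (?p - ?q) z = 0}"
      proof safe
        fix z :: complex assume z: "z ^ n = 1"
        have "poly ?p z = 0" unfolding poly_prod by (rule prod_zero) (use fin z in auto)
        thus "poly (?p - ?q) z = 0" using z by (simp add: poly_monom)
      qed
    qed
    also have "\<dots> \<le> degree (?p - ?q)" using ne by (intro card_poly_roots_bound) auto
    finally show False using deg card_roots_unity_eq[OF assms] by simp
  qed
  thus ?thesis .
qed

lemma prod_prod_primitive_unity_roots:
  assumes "n > 0"
  shows "(\<Prod>d | d dvd n. \<Prod>z\<in>primitive_unity_roots d. [:- z, 1:]) = (monom 1 n - 1 :: complex poly)"
proof -
  have disj: "primitive_unity_roots a \<inter> primitive_unity_roots b = {}"
    if "a \<noteq> b" "a > 0" "b > 0" for a b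
    using that by (auto simp: primitive_unity_roots_def) (metis linorder_neqE_nat)
  have "(\<Prod>d | d dvd n. \<Prod>z\<in>primitive_unity_roots d. [:- z, 1:]) =
        (\<Prod>z\<in>(\<Union>d\<in>{d. d dvd n}. primitive_unity_roots d). [:- z, 1:])"
    using assms
    by (intro prod.UNION_disjoint[symmetric] ballI impI finite_primitive_unity_roots disj)
      (auto intro: dvd_pos_nat)
  thus ?thesis
    using unity_roots_eq_Union_primitive[OF assms] prod_linear_unity_roots[OF assms] by simp
qed

lemma cyclotomic_poly_exists:
  assumes "n > 0"
  shows "\<exists>p::rat poly. map_poly of_rat p = (\<Prod>z\<in>primitive_unity_roots n. [:- z, 1:])"
  using assms
proof (induction n rule: less_induct)
  case (less n)
  let ?C = "\<lambda>d. \<Prod>z\<in>primitive_unity_roots d. [:- z, 1:]"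
  let ?D = "{d. d dvd n} - {n}"
  have "\<forall>d\<in>?D. \<exists>p::rat poly. map_poly of_rat p = ?C d"
    using less dvd_imp_le dvd_pos_nat by (metis DiffD1 DiffD2 insertCI le_neq_implies_less mem_Collect_eq)
  then obtain f :: "nat \<Rightarrow> rat poly" where f: "map_poly of_rat (f d) = ?C d" if "d \<in> ?D" for d
    by metis
  define Q where "Q = prod f ?D"
  let ?Q = "map_poly (of_rat :: rat \<Rightarrow> complex) Q"
  have Q: "?Q = (\<Prod>d\<in>?D. ?C d)"
    by (simp add: Q_def map_of_rat_poly_prod f)
  have "?C d \<noteq> 0" for d
    by (cases "finite (primitive_unity_roots d)") (auto simp: prod_zero_iff)
  hence "?Q \<noteq> 0" using less.prems by (auto simp: Q)
  hence Q0: "Q \<noteq> 0" by auto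
  let ?X = "monom 1 n - 1 :: rat poly"
  have X: "map_poly of_rat ?X = (monom 1 n - 1 :: complex poly)"
    by (intro poly_eqI) (simp add: coeff_map_poly of_rat_diff)
  have fin: "finite {d. d dvd n}" using less.prems by auto
  have "(monom 1 n - 1 :: complex poly) = ?C n * ?Q"
    unfolding Q prod_prod_primitive_unity_roots[OF less.prems, symmetric]
    using fin by (subst prod.remove[of _ n]) auto
  moreover have "?X = ?X div Q * Q + ?X mod Q" by simp
  hence "map_poly of_rat ?X = map_poly of_rat (?X div Q) * ?Q + map_poly of_rat (?X mod Q)"
    by (metis map_of_rat_poly_mult map_of_rat_poly_add)
  ultimately have eq: "(?C n - map_poly of_rat (?X div Q)) * ?Q = map_poly of_rat (?X mod Q)"
    unfolding X by (simp add: algebra_simps)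
  have deg: "degree (map_poly (of_rat :: rat \<Rightarrow> complex) p) = degree p" for p
    by (intro degree_map_poly) auto
  have "?C n - map_poly of_rat (?X div Q) = 0"
  proof (rule ccontr)
    assume ne: "?C n - map_poly of_rat (?X div Q) \<noteq> 0"
    hence "degree (map_poly (of_rat :: rat \<Rightarrow> complex) (?X mod Q)) \<ge> degree ?Q"
      unfolding eq[symmetric] using \<open>?Q \<noteq> 0\<close> by (subst degree_mult_eq) auto
    moreover have "?X mod Q \<noteq> 0" using eq ne \<open>?Q \<noteq> 0\<close> by auto
    ultimately show False using degree_mod_less[OF Q0, of ?X] by (simp add: deg)
  qed
  thus ?case by (intro exI[of _ "?X div Q"]) simp
qed

lemma of_rat_cyclotomic_poly:
  assumes "n > 0"
  shows "map_poly of_rat (cyclotomic_poly n) = (\<Prod>z\<in>primitive_unity_roots n. [:- z, 1:])"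
  unfolding cyclotomic_poly_def
proof (rule theI')
  show "\<exists>!p. map_poly of_rat p = (\<Prod>z\<in>primitive_unity_roots n. [:- z, 1:])"
    using cyclotomic_poly_exists[OF assms] map_of_rat_poly_inj by metis
qed

lemma prod_cyclotomic_poly:
  assumes "n > 0"
  shows "(\<Prod>d | d dvd n. cyclotomic_poly d) = monom 1 n - 1"
proof (rule map_of_rat_poly_inj)
  have "map_poly of_rat (\<Prod>d | d dvd n. cyclotomic_poly d) =
        (\<Prod>d | d dvd n. \<Prod>z\<in>primitive_unity_roots d. [:- z, 1:])"
    unfolding map_of_rat_poly_prod
    using assms by (intro prod.cong of_rat_cyclotomic_poly) (auto intro: dvd_pos_nat)
  also have "\<dots> = monom 1 n - 1" by (rule prod_prod_primitive_unity_roots[OF assms])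
  also have "\<dots> = map_poly of_rat (monom 1 n - 1)"
    by (intro poly_eqI) (simp add: coeff_map_poly of_rat_diff)
  finally show "map_poly of_rat (\<Prod>d | d dvd n. cyclotomic_poly d) =
    (map_poly of_rat (monom 1 n - 1) :: complex poly)" .
qed

lemma poly_map_of_rat:
  "poly (map_poly of_rat p) (of_rat x :: complex) = of_rat (poly p x)"
  by (induction p) (simp_all add: map_poly_pCons of_rat_add of_rat_mult)

lemma poly_Phi_minus_one_nonzero:
  assumes "n > 0" "n \<noteq> 2"
  shows "poly (Phi n) (- 1) \<noteq> 0"
proof (cases "n = 1")
  case True
  thus ?thesis by (simp add: Phi_def)
next
  case False
  have "poly (cyclotomic_poly n) (- 1) \<noteq> 0"
  proof
    assume "poly (cyclotomic_poly n) (- 1) = 0"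
    hence "poly (map_poly of_rat (cyclotomic_poly n)) (of_rat (- 1) :: complex) = 0"
      unfolding poly_map_of_rat by (simp only: of_rat_0)
    hence "(\<Prod>z\<in>primitive_unity_roots n. - z - 1) = 0"
      by (simp add: of_rat_cyclotomic_poly[OF assms(1)] poly_prod)
    then obtain z where z: "z \<in> primitive_unity_roots n" "- z - 1 = 0"
      using finite_primitive_unity_roots[OF assms(1)] by (meson prod_zero_iff)
    have "(- z) ^ 2 = 1" using z(2) by (simp only: right_minus_eq power_one)
    hence "z ^ 2 = 1" by (simp only: power2_minus)
    moreover have "n > 2" using assms False by linarith
    ultimately show False using z(1) unfolding primitive_unity_roots_def by auto
  qed
  thus ?thesis using False by (simp add: Phi_def)
qed

subsection \<open>Evaluation and the coefficients\<close>

lemma eval_mod_unique: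
  fixes r s a :: "rat poly"
  assumes "degree a > 0" "coprime s a"
  shows "\<exists>!h. degree h < degree a \<and> (\<exists>\<alpha>. [\<alpha> * s = 1] (mod a) \<and> [h = \<alpha> * r] (mod a))"
proof -
  define u v where "u = fst (bezout_coefficients s a)" and "v = snd (bezout_coefficients s a)"
  have "u * s + v * a = gcd s a"
    unfolding u_def v_def by (rule bezout_coefficients_fst_snd)
  also have "gcd s a = 1" using assms(2) by (rule coprime_imp_gcd_eq_1)
  finally have "1 mod a = (u * s + v * a) mod a" by simp
  hence u: "[u * s = 1] (mod a)" unfolding cong_def by (simp only: mod_mult_self1)
  have small: "h mod a = h" if "degree h < degree a" for h :: "rat poly"
    using that by (rule mod_poly_less)
  show ?thesis
  proof (rule ex1I[of _ "(u * r) mod a"])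
    have "a \<noteq> 0" using assms(1) by auto
    hence "degree ((u * r) mod a) < degree a"
      using degree_mod_less[of a "u * r"] assms(1) by (metis degree_0)
    moreover have "[(u * r) mod a = u * r] (mod a)" unfolding cong_def by (rule mod_mod_trivial)
    ultimately show "degree ((u * r) mod a) < degree a \<and>
        (\<exists>\<alpha>. [\<alpha> * s = 1] (mod a) \<and> [(u * r) mod a = \<alpha> * r] (mod a))"
      using u by blast
  next
    fix h
    assume "degree h < degree a \<and> (\<exists>\<alpha>. [\<alpha> * s = 1] (mod a) \<and> [h = \<alpha> * r] (mod a))"
    then obtain w where h: "degree h < degree a" and w: "[w * s = 1] (mod a)" "[h = w * r] (mod a)"
      by blast
    have "[w * (u * s) = w * 1] (mod a)" using u by (rule cong_scalar_left)
    hence "[w = u * (w * s)] (mod a)"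
      unfolding mult_1_right mult.left_commute[of w u s] by (rule cong_sym)
    also have "[u * (w * s) = u * 1] (mod a)" using w(1) by (rule cong_scalar_left)
    finally have "[w = u] (mod a)" unfolding mult_1_right .
    hence "[w * r = u * r] (mod a)" by (rule cong_scalar_right)
    with w(2) have "[h = u * r] (mod a)" by (rule cong_trans)
    thus "h = (u * r) mod a" unfolding cong_def small[OF h] .
  qed
qed

lemma coprime_Phi_prod:
  "coprime (\<Prod>i\<in>{1..N} - {2}. Phi i ^ (N div i)) ([:1, 1:] ^ M)"
proof -
  have "coprime (Phi i) [:1, 1:]" if "i \<in> {1..N} - {2}" for i
  proof -
    have "poly (Phi i) (- 1) \<noteq> 0" using that by (intro poly_Phi_minus_one_nonzero) auto
    hence c: "is_unit [:poly (Phi i) (- 1):]" by (simp add: is_unit_poly_iff dvd_field_iff)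
    show ?thesis
    proof (rule coprimeI)
      fix d assume d: "d dvd Phi i" "d dvd [:1, 1:]"
      have "[:1, 1:] * synthetic_div (Phi i) (- 1) + [:poly (Phi i) (- 1):] = Phi i"
        using synthetic_div_correct'[of "- 1" "Phi i"] by simp
      hence "d dvd [:poly (Phi i) (- 1):]" using d by (metis dvd_add_right_iff dvd_mult2)
      thus "is_unit d" using c by (rule dvd_trans)
    qed
  qed
  thus ?thesis by (intro prod_coprime_left) simp
qed

lemma h2_unique:
  assumes "N \<ge> 2"
  shows "\<exists>!h. degree h < degree ([:1, 1:] ^ (N div 2) :: rat poly) \<and>
     (\<exists>\<alpha>. [\<alpha> * (\<Prod>i\<in>{1..N} - {2}. Phi i ^ (N div i)) = 1] (mod [:1, 1:] ^ (N div 2)) \<and>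
           [h = \<alpha> * 1] (mod [:1, 1:] ^ (N div 2)))"
  by (intro eval_mod_unique coprime_Phi_prod) (use assms in \<open>auto simp: degree_power_eq\<close>)

lemma degree_h2:
  assumes "N \<ge> 2"
  shows "degree (h2 N) < N div 2"
proof -
  have "degree (h2 N) < degree ([:1, 1:] ^ (N div 2) :: rat poly)"
    unfolding h2_def eval_mod_def by (rule theI'[OF h2_unique[OF assms], THEN conjunct1])
  thus ?thesis by (simp add: degree_power_eq)
qed

lemma Gamma02_unique:
  assumes "N \<ge> 2"
  shows "\<exists>!g. (\<forall>l. l \<notin> {1..N div 2} \<longrightarrow> g l = 0) \<and>
     h2 N = (\<Sum>l = 1..N div 2. smult (g l) ([:1, 1:] ^ (N div 2 - l)))"
proof -
  define M where "M = N div 2"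
  define q where "q = pcompose (h2 N) [:- 1, 1:]"
  have comp: "pcompose [:1, 1:] [:- 1, 1 :: rat:] = monom 1 1"
    by (simp add: pcompose_pCons monom_altdef)
  have pw: "pcompose (p ^ k) r = pcompose p r ^ k" for p r :: "rat poly" and k
    by (induction k) (simp_all add: pcompose_1 pcompose_mult)
  have inj: "p = p'" if "pcompose p [:- 1, 1 :: rat:] = pcompose p' [:- 1, 1:]" for p p'
  proof -
    have "pcompose [:- 1, 1:] [:1, 1 :: rat:] = [:0, 1:]" by (simp add: pcompose_pCons)
    thus ?thesis using arg_cong[OF that, of "\<lambda>p. pcompose p [:1, 1:]"]
      by (simp add: pcompose_assoc[symmetric])
  qed
  have pc: "pcompose (\<Sum>l = 1..M. smult (g l) ([:1, 1:] ^ (M - l))) [:- 1, 1:] =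
      (\<Sum>l = 1..M. monom (g l) (M - l))" for g :: "nat \<Rightarrow> rat"
    by (simp add: pcompose_sum pcompose_smult pw comp monom_power smult_monom)
  have co: "coeff (\<Sum>l = 1..M. monom (g l) (M - l)) k = (if k < M then g (M - k) else 0)"
    for g :: "nat \<Rightarrow> rat" and k
  proof -
    have "coeff (\<Sum>l = 1..M. monom (g l) (M - l)) k = (\<Sum>l = 1..M. if l = M - k \<and> k < M then g l else 0)"
      unfolding coeff_sum by (intro sum.cong) auto
    also have "\<dots> = (if k < M then g (M - k) else 0)" by auto
    finally show ?thesis .
  qed
  have iff: "h2 N = (\<Sum>l = 1..M. smult (g l) ([:1, 1:] ^ (M - l))) \<longleftrightarrow>
      (\<forall>k. coeff q k = (if k < M then g (M - k) else 0))" for g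
  proof -
    have "h2 N = (\<Sum>l = 1..M. smult (g l) ([:1, 1:] ^ (M - l))) \<longleftrightarrow>
        q = (\<Sum>l = 1..M. monom (g l) (M - l))"
      using inj pc[of g] unfolding q_def by metis
    thus ?thesis by (simp only: poly_eq_iff co)
  qed
  have "degree q < M" using degree_h2[OF assms] by (simp add: q_def M_def degree_pcompose)
  hence big: "coeff q k = 0" if "\<not> k < M" for k using that by (intro coeff_eq_0) auto
  show ?thesis unfolding M_def[symmetric] iff
  proof (rule ex1I[of _ "\<lambda>l. if l \<in> {1..M} then coeff q (M - l) else 0"])
    fix g
    assume g: "(\<forall>l. l \<notin> {1..M} \<longrightarrow> g l = 0) \<and> (\<forall>k. coeff q k = (if k < M then g (M - k) else 0))"
    show "g = (\<lambda>l. if l \<in> {1..M} then coeff q (M - l) else 0)"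
      using g by (intro ext) auto
  next
    let ?g = "\<lambda>l. if l \<in> {1..M} then coeff q (M - l) else 0"
    have "coeff q k = (if k < M then ?g (M - k) else 0)" for k
      using big[of k] by (cases "k < M") simp_all
    thus "(\<forall>l. l \<notin> {1..M} \<longrightarrow> ?g l = 0) \<and> (\<forall>k. coeff q k = (if k < M then ?g (M - k) else 0))"
      by simp
  qed
qed

lemma h2_eq_sum_Gamma02:
  "N \<ge> 2 \<Longrightarrow> h2 N = (\<Sum>l = 1..N div 2. smult (Gamma02 N l) ([:1, 1:] ^ (N div 2 - l)))"
  unfolding Gamma02_def by (rule theI'[OF Gamma02_unique, THEN conjunct2])

subsection \<open>The index set of the main sum\<close>

lemma finite_compositions:
  fixes N j :: nat
  shows "finite {J. J \<in> {1..N} \<rightarrow>\<^sub>E (UNIV :: nat set) \<and> (\<Sum>i = 1..N. J i) = j}"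
proof (rule finite_subset)
  show "{J. J \<in> {1..N} \<rightarrow>\<^sub>E (UNIV :: nat set) \<and> (\<Sum>i = 1..N. J i) = j} \<subseteq> {1..N} \<rightarrow>\<^sub>E {..j}"
    by (auto simp: PiE_def Pi_def intro!: member_le_sum)
  show "finite ({1..N} \<rightarrow>\<^sub>E {..j})"
    by (intro finite_PiE) auto
qed

end

(* Put y = 1 + x.  Substituting t = - n y turns (1 + t / n)^n into (1 - y)^n = (- x)^n, so
   G_n(y) = sum_k gamma_k(n) (- y)^k / k! is 2 / (1 - x^n) for odd n and n y / (1 - x^n) for
   even n.  Hence G_1 ... G_N = 2^N M! / D, where (1 - x) ... (1 - x^N) = y^M D, and the
   expansion of 1 / D in powers of y agrees with h_2 below y^M. *)

theory Submission
  imports Defs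
begin

section \<open>Cyclotomic factorisation of \<open>1 - x^n\<close>\<close>

text \<open>The convention \<open>Phi 1 = 1 - x\<close> flips the sign of exactly one cyclotomic
  factor of \<open>x^n - 1\<close>.\<close>

lemma prod_Phi_dvd:
  assumes "n > 0"
  shows "(\<Prod>d | d dvd n. Phi d) = 1 - monom 1 n"
proof -
  have fin: "finite {d. d dvd n}"
    using assms by simp
  have 1: "1 \<in> {d. d dvd n}"
    by simp
  have "cyclotomic_poly 1 = [:- 1, 1:]"
    using prod_cyclotomic_poly[of 1] by (simp add: monom_altdef one_pCons)
  hence Phi_1: "Phi 1 = - cyclotomic_poly 1"
    by (simp add: Phi_def)
  have "(\<Prod>d | d dvd n. Phi d) = Phi 1 * (\<Prod>d\<in>{d. d dvd n} - {1}. cyclotomic_poly d)"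
    by (subst prod.remove[OF fin 1]) (auto simp: Phi_def intro!: prod.cong)
  also have "\<dots> = - (\<Prod>d | d dvd n. cyclotomic_poly d)"
    unfolding Phi_1 prod.remove[OF fin 1, of cyclotomic_poly] by simp
  finally show ?thesis
    using prod_cyclotomic_poly[OF assms] by simp
qed

lemma Phi_2: "Phi 2 = [:1, 1:]"
proof -
  have "{d. d dvd 2} = {1, 2 :: nat}"
    using two_is_prime_nat by (auto simp: prime_nat_iff)
  hence "[:1, - 1:] * Phi 2 = 1 - monom 1 2"
    using prod_Phi_dvd[of 2] by (simp add: Phi_def)
  also have "\<dots> = [:1, - 1:] * [:1, 1:]"
    by (simp add: monom_altdef one_pCons power2_eq_square)
  finally show ?thesis
    by (subst (asm) mult_left_cancel) auto
qed

text \<open>After the two products are exchanged, \<open>Phi d\<close> is counted once for each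
  multiple of \<open>d\<close> up to \<open>N\<close>, hence \<open>N div d\<close> times.\<close>

lemma prod_one_minus_monom:
  "(\<Prod>i = 1..N. 1 - monom 1 i) = (\<Prod>d = 1..N. Phi d ^ (N div d))"
proof -
  have pow: "(\<Prod>i = 1..n. if d dvd i then c else 1) = c ^ (n div d)" if "d > 0"
    for c :: "rat poly" and d n
    using that by (induction n) (auto simp: div_Suc dvd_eq_mod_eq_0 mult.commute)
  have "(\<Prod>i = 1..N. 1 - monom 1 i) = (\<Prod>i = 1..N. \<Prod>d = 1..N. if d dvd i then Phi d else 1)"
  proof (intro prod.cong refl)
    fix i assume i: "i \<in> {1..N}"
    have "(\<Prod>d | d dvd i. Phi d) = (\<Prod>d = 1..N. if d dvd i then Phi d else 1)"
      unfolding prod.inter_restrict[OF finite_atLeastAtMost, symmetric]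
        prod.inter_filter[OF finite_atLeastAtMost, symmetric]
      using i by (intro prod.cong) (auto dest: dvd_imp_le simp: Suc_le_eq intro: dvd_pos_nat)
    thus "1 - monom 1 i = (\<Prod>d = 1..N. if d dvd i then Phi d else 1)"
      using prod_Phi_dvd[of i] i by simp
  qed
  also have "\<dots> = (\<Prod>d = 1..N. \<Prod>i = 1..N. if d dvd i then Phi d else 1)"
    by (rule prod.swap)
  also have "\<dots> = (\<Prod>d = 1..N. Phi d ^ (N div d))"
    by (intro prod.cong refl pow) auto
  finally show ?thesis .
qed

lemma h2_cong:
  assumes "N \<ge> 2"
  shows "[h2 N * (\<Prod>i\<in>{1..N} - {2}. Phi i ^ (N div i)) = 1] (mod [:1, 1:] ^ (N div 2))"
proof -
  let ?s = "\<Prod>i\<in>{1..N} - {2}. Phi i ^ (N div i)" and ?a = "[:1, 1:] ^ (N div 2) :: rat poly"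
  have "\<exists>\<alpha>. [\<alpha> * ?s = 1] (mod ?a) \<and> [h2 N = \<alpha> * 1] (mod ?a)"
    unfolding h2_def eval_mod_def by (rule theI'[OF h2_unique[OF assms], THEN conjunct2])
  then obtain \<alpha> where "[\<alpha> * ?s = 1] (mod ?a)" "[h2 N = \<alpha>] (mod ?a)"
    by auto
  thus ?thesis
    by (meson cong_scalar_right cong_trans)
qed

section \<open>Expansion in powers of \<open>1 + x\<close>\<close>

text \<open>The indeterminate of the resulting series stands for \<open>1 + x\<close>.\<close>

definition fps_at_minus_one :: "rat poly \<Rightarrow> rat fps" where
  "fps_at_minus_one p = fps_of_poly (pcompose p [:- 1, 1:])"

lemma fps_at_minus_one_mult:
  "fps_at_minus_one (p * q) = fps_at_minus_one p * fps_at_minus_one q"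
  by (simp add: fps_at_minus_one_def pcompose_mult fps_of_poly_mult)

lemma fps_at_minus_one_power: "fps_at_minus_one (p ^ n) = fps_at_minus_one p ^ n"
  by (induction n) (simp_all add: fps_at_minus_one_mult, simp add: fps_at_minus_one_def pcompose_1)

lemma fps_at_minus_one_monom: "fps_at_minus_one (monom 1 n) = (fps_X - 1) ^ n"
  by (simp add: monom_altdef fps_at_minus_one_power)
    (simp add: fps_at_minus_one_def pcompose_pCons fps_of_poly_pCons)

lemma fps_at_minus_one_simps:
  "fps_at_minus_one 1 = 1"
  "fps_at_minus_one [:1, 1:] = fps_X"
  "fps_at_minus_one (p + q) = fps_at_minus_one p + fps_at_minus_one q"
  "fps_at_minus_one (p - q) = fps_at_minus_one p - fps_at_minus_one q"
  "fps_at_minus_one (smult c p) = fps_const c * fps_at_minus_one p"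
  by (simp_all add: fps_at_minus_one_def pcompose_1 pcompose_pCons pcompose_add pcompose_diff
      pcompose_smult fps_of_poly_add fps_of_poly_diff fps_of_poly_smult)

lemma fps_at_minus_one_sum: "fps_at_minus_one (sum f A) = (\<Sum>x\<in>A. fps_at_minus_one (f x))"
  by (simp add: fps_at_minus_one_def pcompose_sum fps_of_poly_sum)

lemma fps_at_minus_one_prod: "fps_at_minus_one (prod f A) = (\<Prod>x\<in>A. fps_at_minus_one (f x))"
  by (induction A rule: infinite_finite_induct)
    (simp_all add: fps_at_minus_one_simps fps_at_minus_one_mult)

lemma fps_at_minus_one_h2_nth:
  assumes "N \<ge> 2" "k < N div 2"
  shows "fps_nth (fps_at_minus_one (h2 N)) k = Gamma02 N (N div 2 - k)"
proof -
  define M where "M = N div 2"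
  have k: "k < M" using assms by (simp add: M_def)
  have "fps_nth (fps_at_minus_one (h2 N)) k =
      (\<Sum>l = 1..M. fps_nth (fps_const (Gamma02 N l) * fps_X ^ (M - l)) k)"
    using h2_eq_sum_Gamma02[OF assms(1)]
    by (simp add: fps_at_minus_one_sum fps_at_minus_one_simps fps_at_minus_one_mult
        fps_at_minus_one_power fps_at_minus_one_monom fps_sum_nth M_def)
  \<comment> \<open>For \<open>k < M\<close> the index \<open>M - k\<close> lies in
    \<open>{1..M}\<close> and is the only \<open>l\<close> there with
    \<open>M - l = k\<close>.\<close>
  also have "\<dots> = (\<Sum>l = 1..M. if l = M - k then Gamma02 N l else 0)"
    using k by (intro sum.cong) auto
  also have "\<dots> = Gamma02 N (M - k)"
    using k by auto
  finally show ?thesis by (simp add: M_def)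
qed

section \<open>Generating functions of the numbers \<open>gamma_tilde\<close>\<close>

definition gamma_tilde_gf :: "nat \<Rightarrow> rat fps" where
  "gamma_tilde_gf n = Abs_fps (\<lambda>k. (- 1) ^ k * (gamma_tilde k n / fact k))"

text \<open>The power \<open>(1 - X)^n\<close> is \<open>- (X - 1)^n\<close> for odd
  \<open>n\<close> and \<open>(X - 1)^n\<close> for even \<open>n\<close>. So the \<open>+ 1\<close>
  of the Euler series and the \<open>- 1\<close> of the Bernoulli series both lead to
  \<open>1 - (X - 1)^n\<close> up to sign.\<close>

lemma gamma_tilde_gf:
  assumes "n > 0"
  shows "gamma_tilde_gf n * (1 - (fps_X - 1) ^ n) =
    (if odd n then 2 else of_nat n * fps_X)"
proof -
  define L where "L = (fps_const (- of_nat n) * fps_X :: rat fps)"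
  have L0: "fps_nth L 0 = 0" by (simp add: L_def)
  have pw: "(- of_nat n :: rat) ^ k = (- 1) ^ k * of_nat n ^ k" for k
    by (rule power_minus)
  \<comment> \<open>Composition with \<open>L\<close> thus sends the base \<open>1 + X / n\<close>
    of \<open>degenerate_exp (1 / n)\<close> to \<open>1 - X\<close>.\<close>
  have "fps_const (1 / of_nat n) * L = - fps_X"
    using assms by (simp add: L_def mult.assoc[symmetric] fps_const_mult[symmetric]
      del: fps_const_neg fps_const_mult)
  hence E: "fps_compose (degenerate_exp (1 / of_nat n)) L = (1 - fps_X) ^ n"
    using assms L0
    by (simp add: degenerate_exp_inverse_nat fps_compose_power[symmetric] fps_compose_add_distrib
        fps_compose_mult_distrib)
  show ?thesis
  proof (cases "odd n")
    case True
    \<comment> \<open>Composing with \<open>L\<close> multiplies the \<open>k\<close>-th coefficient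
      by \<open>(- n)^k\<close>: the factor \<open>n^k\<close> is part of
      \<open>gamma_tilde\<close>, the sign part of \<open>gamma_tilde_gf\<close>.\<close>
    have "fps_compose (Abs_fps (\<lambda>k. degenerate_euler k (1 / of_nat n) / fact k)) L = gamma_tilde_gf n"
      unfolding L_def fps_compose_linear using True
      by (intro fps_ext) (simp add: gamma_tilde_gf_def gamma_tilde_def pw)
    hence "gamma_tilde_gf n * ((1 - fps_X) ^ n + 1) = 2"
      using arg_cong[OF degenerate_euler_gf[of "1 / of_nat n"], of "\<lambda>f. fps_compose f L"] E L0
      by (simp add: fps_compose_mult_distrib fps_compose_add_distrib)
    moreover have "1 - (fps_X - 1) ^ n = (1 - fps_X) ^ n + (1 :: rat fps)"
      by (metis True add.commute diff_minus_eq_add minus_diff_eq power_minus_odd)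
    ultimately show ?thesis
      by (simp only: True not_False_eq_True if_True)
  next
    case False
    have "fps_compose (Abs_fps (\<lambda>k. degenerate_bernoulli k (1 / of_nat n) / fact k)) L = gamma_tilde_gf n"
      unfolding L_def fps_compose_linear using False
      by (intro fps_ext) (simp add: gamma_tilde_gf_def gamma_tilde_def pw)
    moreover have "L = - (of_nat n * fps_X)"
      by (simp add: L_def fps_of_nat[symmetric] fps_const_neg[symmetric] del: fps_const_neg)
    ultimately have "gamma_tilde_gf n * ((1 - fps_X) ^ n - 1) = - (of_nat n * fps_X)"
      using arg_cong[OF degenerate_bernoulli_gf[of "1 / of_nat n"], of "\<lambda>f. fps_compose f L"]
        E L0 assms
      by (simp add: fps_compose_mult_distrib fps_compose_sub_distrib)
    hence "gamma_tilde_gf n * (1 - (1 - fps_X) ^ n) = of_nat n * fps_X"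
      by (metis (no_types, lifting) minus_diff_eq minus_minus mult_minus_right)
    moreover have "(fps_X - 1) ^ n = (1 - fps_X :: rat fps) ^ n"
      using False by (metis minus_diff_eq power_minus_even)
    ultimately show ?thesis
      by (simp only: False if_False)
  qed
qed

lemma gamma_tilde_gf_nth_0:
  assumes "n > 0"
  shows "fps_nth (gamma_tilde_gf n) 0 = 1"
proof -
  have c: "1 / of_nat n \<noteq> (0 :: rat)" using assms by simp
  have "degenerate_euler 0 (1 / of_nat n) = 1"
    using arg_cong[OF degenerate_euler_gf[of "1 / of_nat n"], of "\<lambda>f. fps_nth f 0"]
    by (simp add: degenerate_exp_nth_0)
  \<comment> \<open>Compared at degree 1, because \<open>degenerate_exp c - 1\<close> has no
    constant term.\<close>
  moreover have "degenerate_bernoulli 0 (1 / of_nat n) = 1"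
    using arg_cong[OF degenerate_bernoulli_gf[OF c], of "\<lambda>f. fps_nth f 1"]
    using degenerate_exp_nth_1[OF c] by (simp add: fps_mult_nth degenerate_exp_nth_0)
  ultimately show ?thesis
    by (simp add: gamma_tilde_gf_def gamma_tilde_def)
qed

text \<open>Every index contributes a 2, since an even one is \<open>i = 2 * m\<close>; the
  remaining \<open>m\<close> multiply to the factorial, with one \<open>X\<close> for each even
  index.\<close>

lemma prod_odd_even:
  "(\<Prod>i = 1..N. if odd i then 2 else of_nat i * fps_X) =
    (2 ^ N * fact (N div 2) * fps_X ^ (N div 2) :: rat fps)"
proof (induction N)
  case (Suc N)
  show ?case
  proof (cases "odd N")
    case True
    then obtain m where m: "N = 2 * m + 1" by (elim oddE)
    have "Suc N div 2 = Suc m" "N div 2 = m" "Suc N = 2 * Suc m" using m by simp_all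
    thus ?thesis using Suc True by (simp add: algebra_simps)
  next
    case False
    hence "Suc N div 2 = N div 2" by simp
    thus ?thesis using Suc False by (simp add: algebra_simps)
  qed
qed simp

section \<open>Coefficients of a finite product of series\<close>

text \<open>Iterated Cauchy product. Extensional functions make each tuple of exponents occur
  exactly once.\<close>

lemma fps_prod_nth_PiE:
  fixes f :: "'b \<Rightarrow> 'a :: comm_semiring_1 fps"
  assumes "finite A"
  shows "fps_nth (prod f A) j =
    (\<Sum>J | J \<in> A \<rightarrow>\<^sub>E (UNIV :: nat set) \<and> sum J A = j. \<Prod>i\<in>A. fps_nth (f i) (J i))"
  using assms
proof (induction A arbitrary: j rule: finite_induct)
  case empty
  have "{J. J = (\<lambda>_ :: 'b. undefined) \<and> 0 = j} = (if j = 0 then {\<lambda>_. undefined :: nat} else {})"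
    by auto
  then show ?case by simp
next
  case (insert a A)
  let ?S = "\<lambda>A j. {J. J \<in> A \<rightarrow>\<^sub>E (UNIV :: nat set) \<and> sum J A = j}"
  have fin: "finite (?S A m)" for m
  proof (rule finite_subset)
    show "?S A m \<subseteq> A \<rightarrow>\<^sub>E {..m}"
      using insert.hyps by (auto simp: PiE_def Pi_def intro!: member_le_sum)
    show "finite (A \<rightarrow>\<^sub>E {..m})"
      using insert.hyps by (intro finite_PiE) auto
  qed
  have "fps_nth (prod f (insert a A)) j =
      (\<Sum>m\<le>j. \<Sum>J\<in>?S A (j - m). fps_nth (f a) m * (\<Prod>i\<in>A. fps_nth (f i) (J i)))"
    using insert by (simp add: fps_mult_nth sum_distrib_left atLeast0AtMost)
  also have "\<dots> = (\<Sum>(m, J)\<in>(SIGMA m:{..j}. ?S A (j - m)).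
      fps_nth (f a) m * (\<Prod>i\<in>A. fps_nth (f i) (J i)))"
    by (rule sum.Sigma) (use fin in auto)
  also have "\<dots> = (\<Sum>J\<in>?S (insert a A) j. \<Prod>i\<in>insert a A. fps_nth (f i) (J i))"
  \<comment> \<open>The exponent \<open>m\<close> of the new factor becomes the value at
    \<open>a\<close>; on the way back that value is reset to \<open>undefined\<close> to keep
    \<open>J\<close> extensional on \<open>A\<close>.\<close>
  proof (rule sum.reindex_bij_witness[where i = "\<lambda>J. (J a, J(a := undefined))" and
        j = "\<lambda>(m, J). J(a := m)"], goal_cases)
    case (1 x)
    then show ?case using insert.hyps by (auto simp: PiE_def extensional_def)
  next
    case (2 x)
    have "sum (x(a := m)) A = sum x A" for x :: "_ \<Rightarrow> nat" and m
      using insert.hyps by (intro sum.cong) auto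
    then show ?case using 2 insert.hyps by (auto simp: PiE_def extensional_def)
  next
    case (3 J)
    then show ?case by auto
  next
    case (4 J)
    have "sum (J(a := undefined)) A = sum J A"
      using insert.hyps by (intro sum.cong) auto
    then show ?case using 4 insert.hyps by (auto simp: PiE_def extensional_def)
  next
    case (5 x)
    obtain m J where x: "x = (m, J)" by (cases x)
    have "(\<Prod>i\<in>A. fps_nth (f i) ((J(a := m)) i)) = (\<Prod>i\<in>A. fps_nth (f i) (J i))"
      using insert.hyps by (intro prod.cong) auto
    then show ?case
      by (simp only: x prod.case prod.insert[OF insert.hyps] fun_upd_same)
  qed
  finally show ?case .
qed

section \<open>Comparison of coefficients below \<open>(1 + x)^M\<close>\<close>

theorem mainTheorem2:
  fixes N M :: nat
  assumes "N \<ge> 2" and "M = N div 2"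
  shows "Gamma02 N M = 1 / (2 ^ N * fact M) \<and>
    (\<forall>j. 1 \<le> j \<and> j < M \<longrightarrow>
      Gamma02 N (M - j) =
        (- 1) ^ j / (2 ^ N * fact M) *
        (\<Sum>J | J \<in> {1..N} \<rightarrow>\<^sub>E (UNIV :: nat set) \<and> (\<Sum>i = 1..N. J i) = j.
           (\<Prod>i = 1..N. gamma_tilde (J i) i) / (\<Prod>i = 1..N. fact (J i))))"
proof -
  define D where "D = (\<Prod>i\<in>{1..N} - {2}. Phi i ^ (N div i))"
  define P where "P = (\<Prod>i = 1..N. gamma_tilde_gf i)"
  define c where "c = (2 ^ N * fact M :: rat)"
  let ?E = fps_at_minus_one
  have M: "M > 0" using assms by simp
  \<comment> \<open>The factor split off is \<open>i = 2\<close>, present since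
    \<open>N \<ge> 2\<close>, with exponent \<open>N div 2 = M\<close>.\<close>
  have "(\<Prod>i = 1..N. 1 - monom 1 i) = [:1, 1:] ^ M * D"
    unfolding prod_one_minus_monom D_def using assms
    by (subst prod.remove[of _ 2]) (simp_all add: Phi_2)
  from arg_cong[OF this, of ?E]
  have "(\<Prod>i = 1..N. 1 - (fps_X - 1) ^ i) = fps_X ^ M * ?E D"
    by (simp add: fps_at_minus_one_prod fps_at_minus_one_simps fps_at_minus_one_mult
        fps_at_minus_one_power fps_at_minus_one_monom)
  hence "P * (fps_X ^ M * ?E D) = (\<Prod>i = 1..N. if odd i then 2 else of_nat i * fps_X)"
    unfolding P_def by (subst \<open>_ = fps_X ^ M * ?E D\<close>[symmetric], subst prod.distrib[symmetric])
      (intro prod.cong refl gamma_tilde_gf, simp)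
  also have "\<dots> = fps_const c * fps_X ^ M"
    using fps_of_nat[of "2 ^ N * fact M", where 'a = rat]
    unfolding prod_odd_even by (simp add: c_def assms(2))
  finally have "fps_X ^ M * (P * ?E D) = fps_X ^ M * fps_const c"
    by (simp add: algebra_simps)
  hence PD: "P * ?E D = fps_const c"
    by simp
  obtain q where "h2 N * D = 1 + [:1, 1:] ^ M * q"
    using h2_cong[OF assms(1)] unfolding D_def[symmetric] assms(2)[symmetric]
    by (metis cong_iff_lin cong_sym)
  from arg_cong[OF this, of ?E] have "?E (h2 N) * ?E D = 1 + fps_X ^ M * ?E q"
    by (simp add: fps_at_minus_one_simps fps_at_minus_one_mult
        fps_at_minus_one_power fps_at_minus_one_monom)
  \<comment> \<open>Multiplying by \<open>P\<close> and using \<open>PD\<close> avoids inverting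
    \<open>?E D\<close>.\<close>
  hence cE: "fps_const c * ?E (h2 N) = P + fps_X ^ M * (P * ?E q)"
    unfolding PD[symmetric] by (simp add: algebra_simps)
  \<comment> \<open>The correction term is a multiple of \<open>X^M\<close>, so it is invisible
    below degree \<open>M\<close>.\<close>
  have "c * fps_nth (?E (h2 N)) j = fps_nth P j" if "j < M" for j
    using that arg_cong[OF cE, of "\<lambda>f. fps_nth f j"] by (simp add: fps_X_power_mult_nth)
  hence G: "c * Gamma02 N (M - j) = fps_nth P j" if "j < M" for j
    using that fps_at_minus_one_h2_nth[OF assms(1)] assms(2) by simp
  \<comment> \<open>The signs \<open>(- 1)^(J i)\<close> combine to \<open>(- 1)^j\<close> because
    the \<open>J i\<close> add up to \<open>j\<close>.\<close>
  have Pj: "fps_nth P j = (- 1) ^ j * (\<Sum>J | J \<in> {1..N} \<rightarrow>\<^sub>E (UNIV :: nat set) \<and> (\<Sum>i = 1..N. J i) = j.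
           (\<Prod>i = 1..N. gamma_tilde (J i) i) / (\<Prod>i = 1..N. fact (J i)))" for j
    unfolding P_def fps_prod_nth_PiE[OF finite_atLeastAtMost] sum_distrib_left
    by (intro sum.cong refl)
      (auto simp: gamma_tilde_gf_def prod.distrib prod_dividef power_sum[symmetric])
  have c: "c > 0" by (simp add: c_def)
  \<comment> \<open>The case \<open>j = 0\<close> needs no sum: constant terms are
    multiplicative.\<close>
  have "fps_nth P 0 = (\<Prod>i = 1..N. fps_nth (gamma_tilde_gf i) 0)"
    unfolding P_def by (induction N) simp_all
  also have "\<dots> = 1"
    by (simp add: gamma_tilde_gf_nth_0)
  finally have "Gamma02 N M = 1 / c"
    using G[OF M] c by (simp add: field_simps)
  moreover have "Gamma02 N (M - j) = fps_nth P j / c" if "j < M" for j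
    using G[OF that] c by (simp add: field_simps)
  ultimately show ?thesis
    by (simp add: Pj c_def)
qed

end
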